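(* Let $0<|q|<1$ and let $x$ be a nonzero complex number with $x\ne q^k$ for every integer $k$. Then $$\sum_{n=-\infty}^{\infty}\frac{q^{3n^2+n}(q^n-1)}{(1-xq^{3n})(1-q^{3n}/x)}-\sum_{n=-\infty}^{\infty}\frac{q^{3n^2+4n+1}(1-q^{3n+1})}{(1-xq^{3n+1})(1-q^{3n+1}/x)}=\frac{(q;q)_\infty^2}{(x,1/x;q)_\infty}\sum_{n=0}^{\infty}\frac{(x,1/x;q)_n}{(q;q)_{2n}}(q^n-1)q^{n^2}$$ and $$\sum_{n=-\infty}^{\infty}\frac{q^{3n^2+2n}}{(1-xq^{3n+1})(1-q^{3n+1}/x)}-\sum_{n=-\infty}^{\infty}\frac{q^{3n^2+4n+1}}{(1-xq^{3n+2})(1-q^{3n+2}/x)}=\frac{(q;q)_\infty^2}{(xq,q/x;q)_\infty}\sum_{n=0}^{\infty}\frac{(xq,q/x;q)_n}{(q;q)_{2n+1}}q^{n^2+n}.$$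
   Context: $(x;q)_\infty=\prod_{n\ge0}(1-xq^n)$, $(x;q)_n=\prod_{i=0}^{n-1}(1-xq^i)$ for $n\ge0$, and $(a,b;q)_n=(a;q)_n(b;q)_n$, also for $n=\infty$. *)

theory Defs
  imports "HOL-Analysis.Analysis"
begin

definition qpoch :: "complex \<Rightarrow> complex \<Rightarrow> nat \<Rightarrow> complex" where
  "qpoch x q n = (\<Prod>i<n. 1 - x * q ^ i)"

definition qpoch_inf :: "complex \<Rightarrow> complex \<Rightarrow> complex" where
  "qpoch_inf x q = (\<Prod>n. 1 - x * q ^ n)"

definition qpoch2 :: "complex \<Rightarrow> complex \<Rightarrow> complex \<Rightarrow> nat \<Rightarrow> complex" where
  "qpoch2 a b q n = qpoch a q n * qpoch b q n"

definition qpoch2_inf :: "complex \<Rightarrow> complex \<Rightarrow> complex \<Rightarrow> complex" where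
  "qpoch2_inf a b q = qpoch_inf a q * qpoch_inf b q"

text \<open>
  An infinite product in the library has a meaningful value only if it converges, where
  finitely many factors may vanish. For \<open>|q| < 1\<close> this is always the case here.
\<close>

lemma qpoch_inf_has_prod:
  assumes "norm q < 1"
  shows "(\<lambda>n. 1 - x * q ^ n) has_prod qpoch_inf x q"
proof -
  have "summable (\<lambda>n. norm x * norm q ^ n)"
    using assms by (intro summable_mult summable_geometric) simp
  then have "summable (\<lambda>n. norm ((1 - x * q ^ n) - 1))"
    by (simp add: norm_mult norm_power)
  then have "convergent_prod (\<lambda>n. 1 - x * q ^ n)"
    by (intro abs_convergent_prod_imp_convergent_prod summable_imp_abs_convergent_prod)
  then show ?thesis
    unfolding qpoch_inf_def by (rule convergent_prod_has_prod)
qed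

end

theory Submission
  imports Defs
begin

text \<open>
  Both identities are instances of the Bailey lemma at \<open>a = 1\<close> with parameters \<open>x\<close>, \<open>1/x\<close>.
  Put \<open>u(k) = 1/(q;q)\<^sub>k\<close> with \<open>u(k) = 0\<close> for \<open>k < 0\<close>. The conjugate Bailey pair is elementary because
  \<open>\<Sum>r<K. (x,1/x;q)\<^sub>r q^r u(r-n) u(r+n)\<close> telescopes to
  \<open>(x,1/x;q)\<^sub>K h(n) u(K-1-n) u(K-1+n)\<close> where \<open>h(n) = q^n/((1-xq^n)(1-q^n/x))\<close>. Multiplying by the
  weights \<open>q^(3m^2+em)\<close> at \<open>n = 3m+c\<close>, summing over \<open>m\<close> and letting \<open>K\<close> tend to infinity by dominated
  convergence turns a bilateral series in \<open>h(3m+c)\<close> into a series in \<open>(x,1/x;q)\<^sub>r q^r\<close>.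

  The coefficients that arise are alternating sums of q-binomials. The two q-Pascal rules couple the
  families \<open>A\<close> and \<open>B\<close> below, and reflection \<open>m \<mapsto> -m\<close> kills \<open>A N (N-1)\<close> and \<open>B N (N+2)\<close>; between
  these two lines of zeros the recursion collapses to a single monomial. For the second identity one
  writes \<open>(x,1/x;q)\<^bsub>n+1\<^esub> = (1-x)(1-1/x)(xq,q/x;q)\<^sub>n\<close> and shifts the summation index.
\<close>

section \<open>Unconditional sums and geometric decay over the integers\<close>

lemma has_sum_minus:
  fixes f g :: "'a \<Rightarrow> 'b :: topological_ab_group_add"
  assumes "(f has_sum s) A" "(g has_sum t) A"
  shows "((\<lambda>x. f x - g x) has_sum (s - t)) A"
  using has_sum_add[OF assms(1), of "\<lambda>x. - g x" "- t"] assms(2) by (simp add: has_sum_uminus)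

lemma has_sum_sum:
  fixes f :: "'i \<Rightarrow> 'a \<Rightarrow> 'b :: topological_comm_monoid_add"
  assumes "\<And>i. i \<in> I \<Longrightarrow> (f i has_sum s i) A"
  shows "((\<lambda>x. \<Sum>i\<in>I. f i x) has_sum (\<Sum>i\<in>I. s i)) A"
  using assms by (induction I rule: infinite_finite_induct) (auto intro: has_sum_add)

lemma summable_on_power_abs_int:
  fixes r :: real
  assumes "0 < r" "r < 1"
  shows "(\<lambda>m::int. r powi \<bar>m\<bar>) summable_on UNIV"
proof -
  have nat: "(\<lambda>n::nat. r ^ n) summable_on UNIV"
    using assms by (intro norm_summable_imp_summable_on) (simp add: summable_geometric)
  have pos: "(\<lambda>m::int. r powi \<bar>m\<bar>) summable_on {0..}"
    using nat
    by (subst summable_on_reindex_bij_witness[of _ int nat UNIV "\<lambda>n. r ^ n"])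
       (auto simp: power_int_def)
  have "(\<lambda>n::nat. r * r ^ n) summable_on UNIV"
    using nat by (rule summable_on_cmult_right)
  then have neg: "(\<lambda>m::int. r powi \<bar>m\<bar>) summable_on {..<0}"
    by (subst summable_on_reindex_bij_witness[of _ "\<lambda>n. - int n - 1" "\<lambda>m. nat (- m - 1)" UNIV "\<lambda>n. r * r ^ n"])
       (auto simp: power_int_def simp flip: power_Suc intro!: arg_cong[where f = "\<lambda>n. r ^ n"])
  have "(\<lambda>m::int. r powi \<bar>m\<bar>) summable_on ({0..} \<union> {..<0})"
    using pos neg by (rule summable_on_Un_disjoint) auto
  also have "{0..} \<union> {..<0} = (UNIV :: int set)" by auto
  finally show ?thesis .
qed

section \<open>Finite and infinite q-Pochhammer symbols\<close>

lemma qpoch_0 [simp]: "qpoch x q 0 = 1"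
  by (simp add: qpoch_def)

lemma qpoch_Suc: "qpoch x q (Suc n) = (1 - x * q ^ n) * qpoch x q n"
  by (simp add: qpoch_def)

lemma qpoch_Suc_shift: "qpoch x q (Suc n) = (1 - x) * qpoch (x * q) q n"
  unfolding qpoch_def by (subst prod.lessThan_Suc_shift) (simp add: mult_ac)

lemma qpoch2_Suc_shift:
  "qpoch2 x y q (Suc n) = (1 - x) * (1 - y) * qpoch2 (x * q) (y * q) q n"
  by (simp add: qpoch2_def qpoch_Suc_shift)

lemma qpoch_tendsto:
  assumes "norm q < 1"
  shows "qpoch x q \<longlonglongrightarrow> qpoch_inf x q"
  using has_prod_imp_tendsto'[OF qpoch_inf_has_prod[OF assms, of x]]
  unfolding qpoch_def[abs_def] .

lemma qpoch2_tendsto: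
  assumes "norm q < 1"
  shows "qpoch2 x y q \<longlonglongrightarrow> qpoch2_inf x y q"
  unfolding qpoch2_def[abs_def] qpoch2_inf_def by (intro tendsto_mult qpoch_tendsto assms)

lemma qpoch2_inf_shift:
  assumes "norm q < 1"
  shows "qpoch2_inf x y q = (1 - x) * (1 - y) * qpoch2_inf (x * q) (y * q) q"
proof (rule LIMSEQ_unique)
  show "(\<lambda>n. qpoch2 x y q (Suc n)) \<longlonglongrightarrow> qpoch2_inf x y q"
    by (rule LIMSEQ_Suc[OF qpoch2_tendsto[OF assms]])
  show "(\<lambda>n. qpoch2 x y q (Suc n)) \<longlonglongrightarrow> (1 - x) * (1 - y) * qpoch2_inf (x * q) (y * q) q"
    unfolding qpoch2_Suc_shift by (intro tendsto_mult tendsto_const qpoch2_tendsto assms)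
qed

lemma qpoch_inf_nonzero:
  assumes "norm q < 1" "\<And>n. x * q ^ n \<noteq> 1"
  shows "qpoch_inf x q \<noteq> 0"
proof
  assume "qpoch_inf x q = 0"
  then obtain n where "1 - x * q ^ n = 0"
    using has_prod_eq_0_iff[OF qpoch_inf_has_prod[OF assms(1), of x]] by force
  with assms(2)[of n] show False by simp
qed

section \<open>Reciprocal q-factorials on the punctured unit disc\<close>

locale punctured_disc =
  fixes q :: complex
  assumes q_pos: "0 < norm q" and q_less: "norm q < 1"
begin

lemma q_nonzero [simp]: "q \<noteq> 0"
  using q_pos by auto

lemma q_power_eq_1_iff: "q ^ n = 1 \<longleftrightarrow> n = 0"
proof
  assume "q ^ n = 1"
  then have "norm q ^ n = 1" by (metis norm_one norm_power)
  then show "n = 0" using power_Suc_less_one[OF q_pos q_less, of "n - 1"] by (cases n) auto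
qed auto

lemma qpoch_q_nonzero [simp]: "qpoch q q n \<noteq> 0"
proof -
  have "1 - q * q ^ i \<noteq> 0" for i
    using q_power_eq_1_iff[of "Suc i"] by auto
  then show ?thesis by (simp add: qpoch_def)
qed

lemma qpoch_inf_q_nonzero: "qpoch_inf q q \<noteq> 0"
proof (rule qpoch_inf_nonzero[OF q_less])
  show "q * q ^ n \<noteq> 1" for n
    using q_power_eq_1_iff[of "Suc n"] by simp
qed

text \<open>This is the \<open>u\<close> of the overview. Extension by zero lets every sum below run
  over all integers and frees the recurrence \<open>ifac_pred\<close> from side conditions.\<close>

definition ifac :: "int \<Rightarrow> complex" where
  "ifac k = (if k \<ge> 0 then 1 / qpoch q q (nat k) else 0)"

lemma ifac_nat [simp]: "ifac (int n) = 1 / qpoch q q n"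
  by (simp add: ifac_def)

lemma ifac_neg [simp]: "k < 0 \<Longrightarrow> ifac k = 0"
  by (simp add: ifac_def)

text \<open>For positive \<open>k\<close> the last factor of (q;q)_k cancels. At
  \<open>k = 0\<close> the factor \<open>1 - q powi 0\<close> vanishes, in agreement with the
  default value at -1; below 0 both sides are zero.\<close>

lemma ifac_pred: "ifac (k - 1) = (1 - q powi k) * ifac k"
proof (cases "k \<le> 0")
  case False
  then have "k = int (Suc (nat (k - 1)))" by simp
  then obtain n where n: "k = int (Suc n)" by blast
  have "1 - q * q ^ n \<noteq> 0"
    using q_power_eq_1_iff[of "Suc n"] by auto
  then show ?thesis
    unfolding n power_int_of_nat ifac_nat by (simp add: qpoch_Suc)
qed (cases "k = 0", auto)

lemma ifac_tendsto: "(\<lambda>n. ifac (int n + c)) \<longlonglongrightarrow> 1 / qpoch_inf q q"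
proof -
  have lim: "(\<lambda>n. 1 / qpoch q q n) \<longlonglongrightarrow> 1 / qpoch_inf q q"
    by (intro tendsto_divide tendsto_const qpoch_tendsto q_less qpoch_inf_q_nonzero)
  have "filterlim (\<lambda>n. nat (int n + c)) at_top at_top"
    unfolding filterlim_at_top eventually_sequentially
  proof
    fix Z
    show "\<exists>N. \<forall>n\<ge>N. Z \<le> nat (int n + c)" by (rule exI[of _ "Z + nat \<bar>c\<bar>"]) auto
  qed
  from filterlim_compose[OF lim this]
  have "(\<lambda>n. 1 / qpoch q q (nat (int n + c))) \<longlonglongrightarrow> 1 / qpoch_inf q q" .
  \<comment> \<open>For \<open>n\<close> at least \<open>\<bar>c\<bar>\<close> the argument is
    nonnegative, so the default value 0 no longer occurs.\<close>
  moreover have "eventually (\<lambda>n. 1 / qpoch q q (nat (int n + c)) = ifac (int n + c)) sequentially"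
    using eventually_ge_at_top[of "nat \<bar>c\<bar>"] by eventually_elim (auto simp: ifac_def)
  ultimately show ?thesis by (rule Lim_transform_eventually)
qed

lemma ifac_bounded: obtains B where "B > 0" "\<And>k. norm (ifac k) \<le> B"
proof -
  have "convergent (\<lambda>n. ifac (int n + 0))"
    using ifac_tendsto[of 0] unfolding convergent_def by blast
  then have "Bseq (\<lambda>n. ifac (int n))"
    using convergent_imp_Bseq by simp
  then obtain B where B: "B > 0" "\<And>n. norm (ifac (int n)) \<le> B"
    by (auto simp: Bseq_def)
  have "norm (ifac k) \<le> B" for k
  proof (cases "k \<ge> 0")
    case True
    then show ?thesis using B(2)[of "nat k"] by simp
  qed (use B in simp)
  with B(1) that show thesis by blast
qed

section \<open>Theta-weighted bilateral sums and their q-Pascal rules\<close>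

lemma theta_abs_summable: "(\<lambda>m::int. norm (q powi (3*m^2 + e*m))) summable_on UNIV"
proof -
  \<comment> \<open>Expanding the square of \<open>\<bar>m\<bar> - (\<bar>e\<bar> + 1)\<close>
    bounds the exponent below by \<open>\<bar>m\<bar> - K\<close>, so a geometric series in
    \<open>\<bar>m\<bar>\<close> dominates.\<close>
  define K where "K = (\<bar>e\<bar> + 1)^2"
  have exp: "\<bar>m\<bar> - K \<le> 3*m^2 + e*m" for m :: int
  proof -
    have "0 \<le> (\<bar>m\<bar> - (\<bar>e\<bar> + 1))^2" by simp
    then have "2 * \<bar>m\<bar> + 2 * (\<bar>m\<bar> * \<bar>e\<bar>) \<le> m^2 + K"
      unfolding K_def power2_diff by (simp add: algebra_simps)
    moreover have "\<bar>m\<bar> * \<bar>e\<bar> \<ge> - (e * m)"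
      by (metis abs_ge_minus_self abs_mult mult.commute)
    moreover have "\<bar>m\<bar> * \<bar>e\<bar> \<ge> 0" "m^2 \<ge> 0" "K \<ge> 0" by (auto simp: K_def)
    ultimately show ?thesis by linarith
  qed
  have "(\<lambda>m::int. norm q powi (-K) * norm q powi \<bar>m\<bar>) summable_on UNIV"
    using q_pos q_less by (intro summable_on_cmult_right summable_on_power_abs_int)
  then show ?thesis
  proof (rule Infinite_Sum.abs_summable_on_comparison_test')
    fix m :: int
    have "norm (q powi (3*m^2 + e*m)) \<le> norm q powi (\<bar>m\<bar> - K)"
      unfolding norm_power_int using exp q_pos q_less by (intro power_int_decreasing) auto
    also have "\<dots> = norm q powi (-K) * norm q powi \<bar>m\<bar>"
      using q_pos by (subst power_int_add[symmetric]) auto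
    finally show "norm (q powi (3*m^2 + e*m)) \<le> norm q powi (-K) * norm q powi \<bar>m\<bar>" .
  qed
qed

lemma theta_bounded_abs_summable:
  assumes "\<And>m. norm (f m) \<le> C"
  shows "(\<lambda>m::int. norm (q powi (3*m^2 + e*m) * f m)) summable_on UNIV"
proof (rule Infinite_Sum.abs_summable_on_comparison_test')
  show "(\<lambda>m::int. norm (q powi (3*m^2 + e*m)) * C) summable_on UNIV"
    by (intro summable_on_cmult_left theta_abs_summable)
qed (simp add: norm_mult mult_left_mono assms)

lemma theta_bounded_summable:
  assumes "\<And>m. norm (f m) \<le> C"
  shows "(\<lambda>m::int. q powi (3*m^2 + e*m) * f m) summable_on UNIV"
  by (rule abs_summable_summable[OF theta_bounded_abs_summable[OF assms]])

text \<open>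
  \<open>(q;q)\<^bsub>N+M\<^esub> S e N M\<close> is the sum of \<open>q^(3m^2+em)\<close> times the q-binomial of \<open>N+M\<close> over \<open>N-3m\<close>.
  Dividing by the factorial makes the q-Pascal rules hold for all integers \<open>N\<close>, \<open>M\<close>.
\<close>

definition S :: "int \<Rightarrow> int \<Rightarrow> int \<Rightarrow> complex" where
  "S e N M = (\<Sum>\<^sub>\<infinity>m::int. q powi (3*m^2 + e*m) * (ifac (N - 3*m) * ifac (M + 3*m)))"

lemma S_has_sum:
  "((\<lambda>m::int. q powi (3*m^2 + e*m) * (ifac (N - 3*m) * ifac (M + 3*m))) has_sum S e N M) UNIV"
proof -
  obtain B where B: "B > 0" "\<And>k. norm (ifac k) \<le> B" using ifac_bounded by blast
  have "norm (ifac (N - 3*m) * ifac (M + 3*m)) \<le> B * B" for m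
    unfolding norm_mult using B by (intro mult_mono) (auto intro: less_imp_le)
  from has_sum_infsum[OF theta_bounded_summable[OF this]] show ?thesis
    unfolding S_def .
qed

lemma S_reflect: "S e N M = S (-e) M N"
  unfolding S_def
  by (rule infsum_reindex_bij_witness[of _ uminus uminus]) (auto simp: mult_ac)

text \<open>Reindexing \<open>m\<close> to \<open>m + 1\<close> moves \<open>3 + e\<close> out of
  the exponent and raises the linear coefficient by 6. Together with \<open>S_reflect\<close> this
  produces the zeros of \<open>B\<close>.\<close>

lemma S_shift: "S e N M = q powi (3 + e) * S (e + 6) (N - 3) (M + 3)"
proof -
  define F where "F m = q powi (3*m^2 + e*m) * (ifac (N - 3*m) * ifac (M + 3*m))" for m
  have F: "F (m + 1) = q powi (3 + e) *
      (q powi (3*m^2 + (e+6)*m) * (ifac (N - 3 - 3*m) * ifac (M + 3 + 3*m)))" for m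
  proof -
    have "3*(m+1)^2 + e*(m+1) = (3 + e) + (3*m^2 + (e+6)*m)"
      by (simp add: power2_eq_square algebra_simps)
    moreover have "N - 3*(m+1) = N - 3 - 3*m" "M + 3*(m+1) = M + 3 + 3*m" by simp_all
    ultimately show ?thesis
      unfolding F_def by (simp only: power_int_add q_nonzero simp_thms mult.assoc)
  qed
  have "S e N M = (\<Sum>\<^sub>\<infinity>m. F (m + 1))"
    unfolding S_def F_def[symmetric]
    by (rule infsum_reindex_bij_witness[of _ "\<lambda>m. m + 1" "\<lambda>m. m - 1"]) auto
  then show ?thesis
    unfolding F S_def by (simp add: infsum_cmult_right')
qed

text \<open>Termwise, put a = q^(N-3m) and b = q^(M+3m) and write 1 - ab = (1 - b) + b(1 - a). By
  \<open>ifac_pred\<close> the factor 1 - b lowers \<open>M\<close> and 1 - a lowers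
  \<open>N\<close>; the q^(3m) in the remaining b raises \<open>e\<close> by 3.\<close>

lemma S_pascal_right:
  "(1 - q powi (N + M)) * S e N M = S e N (M - 1) + q powi M * S (e + 3) (N - 1) M"
proof (rule has_sum_unique)
  show "((\<lambda>m::int. (1 - q powi (N + M)) * (q powi (3*m^2 + e*m) * (ifac (N - 3*m) * ifac (M + 3*m))))
     has_sum ((1 - q powi (N + M)) * S e N M)) UNIV"
    by (intro has_sum_cmult_right S_has_sum)
  have "(1 - q powi (N + M)) * (q powi (3*m^2 + e*m) * (ifac (N - 3*m) * ifac (M + 3*m)))
      = q powi (3*m^2 + e*m) * (ifac (N - 3*m) * ifac (M - 1 + 3*m)) +
        q powi M * (q powi (3*m^2 + (e+3)*m) * (ifac (N - 1 - 3*m) * ifac (M + 3*m)))" for m :: int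
  proof -
    have "q powi (N + M) = q powi (M + 3*m) * q powi (N - 3*m)"
      by (simp add: add.commute flip: power_int_add)
    moreover have "q powi M * q powi (3*m^2 + (e+3)*m) = q powi (3*m^2 + e*m) * q powi (M + 3*m)"
      by (simp flip: power_int_add, simp add: algebra_simps)
    moreover have "ifac (N - 1 - 3*m) = (1 - q powi (N - 3*m)) * ifac (N - 3*m)"
        "ifac (M - 1 + 3*m) = (1 - q powi (M + 3*m)) * ifac (M + 3*m)"
      using ifac_pred[of "N - 3*m"] ifac_pred[of "M + 3*m"] by (simp_all add: algebra_simps)
    ultimately show ?thesis by algebra
  qed
  then show "((\<lambda>m::int. (1 - q powi (N + M)) * (q powi (3*m^2 + e*m) * (ifac (N - 3*m) * ifac (M + 3*m))))
     has_sum (S e N (M - 1) + q powi M * S (e + 3) (N - 1) M)) UNIV"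
    by (simp only:) (intro has_sum_add has_sum_cmult_right S_has_sum)
qed

text \<open>The mirror image of \<open>S_pascal_right\<close> under
  \<open>S_reflect\<close>.\<close>

lemma S_pascal_left:
  "(1 - q powi (N + M)) * S e N M = S e (N - 1) M + q powi N * S (e - 3) N (M - 1)"
  using S_pascal_right[of M N "-e"] S_reflect[of e N M] S_reflect[of e "N - 1" M]
    S_reflect[of "e - 3" N "M - 1"]
  by (simp add: add.commute)

text \<open>The two arguments of \<open>ifac\<close> are opposite, so only a term with both equal to
  0 survives. This supplies the initial values of the recursion.\<close>

lemma S_single:
  assumes "N + M = 0"
  shows "S e N M = (if 3 dvd N then q powi (3*(N div 3)^2 + e*(N div 3)) else 0)"
proof -
  have supp: "q powi (3*m^2 + e*m) * (ifac (N - 3*m) * ifac (M + 3*m)) = (if N = 3*m then q powi (3*m^2 + e*m) else 0)"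
    for m
    using assms ifac_nat[of 0] by (cases "N = 3*m") (auto simp: ifac_def)
  show ?thesis
  proof (cases "3 dvd N")
    case True
    then have *: "N = 3*m \<longleftrightarrow> m = N div 3" for m by auto
    have "S e N M = (\<Sum>\<^sub>\<infinity>m\<in>{N div 3}. q powi (3*m^2 + e*m))"
      unfolding S_def by (rule infsum_cong_neutral) (auto simp: supp *)
    with True show ?thesis by simp
  next
    case False
    then have "N \<noteq> 3*m" for m by auto
    with False show ?thesis unfolding S_def supp by simp
  qed
qed

section \<open>Closed forms for the coupled families \<open>A\<close> and \<open>B\<close>\<close>

definition A :: "int \<Rightarrow> int \<Rightarrow> complex" where
  "A N M = S (-1) N M - S 1 (N - 1) (M + 1)"

text \<open>The right Pascal rule sends the exponents -1, 1 of \<open>A\<close> to 2, 4, and the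
  left rule sends these back. The weight \<open>q\<close> absorbs the discrepancy between q^M and
  q^(M+1), respectively q^(N-1) and q^N, caused by the shifted arguments of the second sum.\<close>

definition B :: "int \<Rightarrow> int \<Rightarrow> complex" where
  "B N M = S 2 N M - q * S 4 (N - 1) (M + 1)"

lemma A_pascal: "(1 - q powi (N + M)) * A N M = A N (M - 1) + q powi M * B (N - 1) M"
  using S_pascal_right[of N M "-1"] S_pascal_right[of "N - 1" "M + 1" 1]
  by (simp add: A_def B_def algebra_simps power_int_add)

lemma B_pascal: "(1 - q powi (N + M)) * B N M = B (N - 1) M + q powi N * A N (M - 1)"
proof -
  have "(1 - q powi (N + M)) * S 2 N M = S 2 (N - 1) M + q powi N * S (-1) N (M - 1)"
    using S_pascal_left[of N M 2] by simp
  moreover have "(1 - q powi (N + M)) * S 4 (N - 1) (M + 1) =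
      S 4 (N - 2) (M + 1) + q powi (N - 1) * S 1 (N - 1) M"
    using S_pascal_left[of "N - 1" "M + 1" 4] by simp
  moreover have "q powi N = q * q powi (N - 1)"
    by (simp add: power_int_diff)
  ultimately show ?thesis
    unfolding A_def B_def by simp algebra
qed

text \<open>On this line reflection carries the first sum of \<open>A\<close> to the second.\<close>

lemma A_boundary: "A N (N - 1) = 0"
  using S_reflect[of "-1" N "N - 1"] by (simp add: A_def)

text \<open>Reflection followed by a shift carries \<open>S 4\<close> to \<open>S 2\<close> with the
  factor 1/q, which cancels the weight \<open>q\<close> in \<open>B\<close>.\<close>

lemma B_boundary: "B N (N + 2) = 0"
  using S_shift[of "-4" "N + 3" "N - 1"] S_reflect[of 4 "N - 1" "N + 3"]
  by (simp add: B_def power_int_minus add.commute)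

lemma one_minus_q_powi_nonzero: "n > 0 \<Longrightarrow> 1 - q powi n \<noteq> 0"
  using q_power_eq_1_iff[of "nat n"] by (simp add: power_int_def)

text \<open>In the Pascal rule for \<open>B\<close> at \<open>(n, n + 1)\<close> one term lies on
  the line of zeros. The diagonal value of \<open>A\<close> is an assumption so that the lemma can
  serve inside the induction that proves it.\<close>

lemma B_offdiag:
  assumes "n \<ge> 0" "A n n = q powi (n^2) * ifac (2*n)"
  shows "B n (n + 1) = q powi (n^2 + n) * ifac (2*n + 1)"
proof -
  have "B (n - 1) (n + 1) = 0"
    using B_boundary[of "n - 1"] by (simp add: add.commute)
  then have "(1 - q powi (2*n + 1)) * B n (n + 1) = q powi n * (q powi (n^2) * ifac (2*n))"
    using B_pascal[of n "n + 1"] assms(2) by (simp add: algebra_simps)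
  also have "ifac (2*n) = (1 - q powi (2*n + 1)) * ifac (2*n + 1)"
    using ifac_pred[of "2*n + 1"] by simp
  finally show ?thesis
    using one_minus_q_powi_nonzero[of "2*n + 1"] assms(1) by (simp add: power_int_add)
qed

text \<open>Each induction step makes two moves, from \<open>A\<close> at (n, n) to \<open>B\<close>
  at (n, n+1) to \<open>A\<close> at (n+1, n+1). Each move loses one term to a line of zeros, so a
  single monomial survives.\<close>

lemma A_diag_nat: "A (int n) (int n) = q powi ((int n)^2) * ifac (2 * int n)"
proof (induction n)
  case 0
  show ?case using S_single[of 0 0 "-1"] S_single[of "-1" 1 1] ifac_nat[of 0]
    by (simp add: A_def)
next
  case (Suc n)
  define k where "k = int n"
  have "B k (k + 1) = q powi (k^2 + k) * ifac (2*k + 1)"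
    using Suc.IH by (intro B_offdiag) (auto simp: k_def)
  then have "(1 - q powi (2*k + 2)) * A (k + 1) (k + 1) = q powi (k + 1) * (q powi (k^2 + k) * ifac (2*k + 1))"
    using A_pascal[of "k + 1" "k + 1"] A_boundary[of "k + 1"] by (simp add: add.commute)
  also have "\<dots> = q powi ((k + 1)^2) * ifac (2*k + 1)"
    by (simp add: power2_eq_square algebra_simps flip: power_int_add mult.assoc)
  also have "ifac (2*k + 1) = (1 - q powi (2*k + 2)) * ifac (2*k + 2)"
    using ifac_pred[of "2*k + 2"] by (simp add: add.commute)
  finally have "A (k + 1) (k + 1) = q powi ((k + 1)^2) * ifac (2*k + 2)"
    using one_minus_q_powi_nonzero[of "2*k + 2"] by (simp add: k_def)
  then show ?case by (simp add: k_def add.commute)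
qed

lemma A_diag: "n \<ge> 0 \<Longrightarrow> A n n = q powi (n^2) * ifac (2 * n)"
  using A_diag_nat[of "nat n"] by simp

lemma B_diag:
  assumes "n \<ge> 0"
  shows "B n n = q powi (n^2 - n) * ifac (2*n)"
\<comment> \<open>The Pascal rule carries the factor \<open>1 - q powi (2*n)\<close>, which cannot
  be cancelled at 0.\<close>
proof (cases "n = 0")
  case True
  then show ?thesis using S_single[of 0 0 2] S_single[of "-1" 1 4] ifac_nat[of 0]
    by (simp add: B_def)
next
  case False
  with assms have n: "n \<ge> 1" by simp
  have "B (n - 1) n = q powi (n^2 - n) * ifac (2*n - 1)"
    using B_offdiag[of "n - 1"] A_diag[of "n - 1"] n by (simp add: power2_eq_square algebra_simps)
  then have "(1 - q powi (2*n)) * B n n = q powi (n^2 - n) * ifac (2*n - 1)"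
    using B_pascal[of n n] A_boundary[of n] by simp
  also have "\<dots> = (1 - q powi (2*n)) * (q powi (n^2 - n) * ifac (2*n))"
    using ifac_pred[of "2*n"] by simp
  finally show ?thesis
    using one_minus_q_powi_nonzero[of "2*n"] n by simp
qed

text \<open>The rule for \<open>A\<close> here needs a value of \<open>B\<close> just outside the
  strip between the lines of zeros, hence two monomials instead of one.\<close>

lemma A_offdiag:
  assumes "n \<ge> 0"
  shows "A (n - 1) (n + 1) = (q powi ((n - 1)^2) - q powi (n^2 + 1)) * ifac (2*n)"
proof (cases "n = 0")
  case True
  then show ?thesis using S_single[of "-1" 1 "-1"] S_single[of "-2" 2 1]
    by (simp add: A_def)
next
  case False
  with assms have n: "n \<ge> 1" by simp
  have pred: "ifac (2*n - 2) = (1 - q powi (2*n - 1)) * ifac (2*n - 1)"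
     "ifac (2*n - 1) = (1 - q powi (2*n)) * ifac (2*n)"
    using ifac_pred[of "2*n - 1"] ifac_pred[of "2*n"] by simp_all
  have "(1 - q powi (2*n - 1)) * A (n - 1) n = A (n - 1) (n - 1)"
    using A_pascal[of "n - 1" n] B_boundary[of "n - 2"] by simp
  also have "\<dots> = (1 - q powi (2*n - 1)) * (q powi ((n - 1)^2) * ifac (2*n - 1))"
    using A_diag[of "n - 1"] n pred(1) by simp
  finally have A1: "A (n - 1) n = q powi ((n - 1)^2) * ifac (2*n - 1)"
    using one_minus_q_powi_nonzero[of "2*n - 1"] n by simp
  have "B (n - 1) (n + 1) = 0"
    using B_boundary[of "n - 1"] by (simp add: add.commute)
  \<comment> \<open>The rule for \<open>B\<close> at one of its zeros is solved backwards for the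
    entry beyond it.\<close>
  then have "B (n - 2) (n + 1) = - (q powi (n - 1) * A (n - 1) n)"
    using B_pascal[of "n - 1" "n + 1"] by (simp add: add_eq_0_iff2)
  then have "(1 - q powi (2*n)) * A (n - 1) (n + 1) =
      A (n - 1) n - q powi (n + 1) * (q powi (n - 1) * A (n - 1) n)"
    using A_pascal[of "n - 1" "n + 1"] by simp
  also have "\<dots> = (q powi ((n - 1)^2) - q powi (n + 1) * q powi (n - 1) * q powi ((n - 1)^2)) * ifac (2*n - 1)"
    by (simp add: A1 algebra_simps)
  also have "q powi (n + 1) * q powi (n - 1) * q powi ((n - 1)^2) = q powi (n^2 + 1)"
    by (simp add: power2_eq_square algebra_simps flip: power_int_add)
  also have "(q powi ((n - 1)^2) - q powi (n^2 + 1)) * ifac (2*n - 1) =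
      (1 - q powi (2*n)) * ((q powi ((n - 1)^2) - q powi (n^2 + 1)) * ifac (2*n))"
    by (simp add: pred(2))
  finally show ?thesis
    using one_minus_q_powi_nonzero[of "2*n"] n by simp
qed

end

section \<open>The kernel \<open>h\<close> and the limiting Bailey lemma\<close>

locale punctured_disc_param = punctured_disc +
  fixes x :: complex
  assumes x_nonzero [simp]: "x \<noteq> 0" and x_not_power: "\<And>k::int. x \<noteq> q powi k"
begin

definition h :: "int \<Rightarrow> complex" where
  "h n = q powi n / ((1 - x * q powi n) * (1 - q powi n / x))"

lemma factors_nonzero: "1 - x * q powi n \<noteq> 0" "1 - q powi n / x \<noteq> 0"
  using x_not_power[of "-n"] x_not_power[of n] by (auto simp: field_simps power_int_minus)

lemma qpoch2_inf_nonzero: "qpoch2_inf x (1/x) q \<noteq> 0"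
proof -
  have "x * q ^ n \<noteq> 1" "1 / x * q ^ n \<noteq> 1" for n
    using factors_nonzero[of "int n"] by auto
  then show ?thesis
    unfolding qpoch2_inf_def by (simp add: qpoch_inf_nonzero q_less)
qed

lemma h_minus: "h (- n) = h n"
  using factors_nonzero[of n] factors_nonzero[of "-n"]
  by (simp add: h_def power_int_minus field_simps) 

text \<open>\<open>h\<close> tends to 0 along the naturals, and \<open>h_minus\<close> transfers the
  bound to negative arguments.\<close>

lemma h_bounded: obtains C where "\<And>n. norm (h n) \<le> C"
proof -
  have q: "(\<lambda>n. q ^ n) \<longlonglongrightarrow> 0"
    using q_less by (rule LIMSEQ_power_zero)
  have "(\<lambda>n. q ^ n / ((1 - x * q ^ n) * (1 - q ^ n / x))) \<longlonglongrightarrow> 0 / ((1 - x * 0) * (1 - 0 / x))"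
    by (intro tendsto_intros q) auto
  then have "(\<lambda>n. h (int n)) \<longlonglongrightarrow> 0"
    by (simp add: h_def)
  then have "Bseq (\<lambda>n. h (int n))"
    using convergent_imp_Bseq convergent_def by blast
  then obtain C where C: "\<And>n. norm (h (int n)) \<le> C"
    by (auto simp: Bseq_def)
  have "norm (h n) \<le> C" for n
    using C[of "nat n"] C[of "nat (-n)"] h_minus[of n] by (cases "n \<ge> 0") auto
  then show thesis by (rule that)
qed

lemma bailey_telescope:
  "(\<Sum>r<K. qpoch2 x (1/x) q r * q ^ r * (ifac (int r - n) * ifac (int r + n))) =
     qpoch2 x (1/x) q K * (h n * (ifac (int K - 1 - n) * ifac (int K - 1 + n)))"
proof (induction K)
  case 0
  \<comment> \<open>The two arguments add up to -2, so one of them is negative.\<close>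
  have "ifac (- 1 - n) * ifac (n - 1) = 0" by (cases "n \<ge> 0") auto
  then show ?case by simp
next
  case (Suc K)
  define P where "P = qpoch2 x (1/x) q K"
  define u where "u = ifac (int K - n) * ifac (int K + n)"
  have pred: "ifac (int K - 1 - n) * ifac (int K - 1 + n) = (1 - q powi (int K - n)) * (1 - q powi (int K + n)) * u"
  proof -
    have "int K - 1 - n = int K - n - 1" "int K - 1 + n = int K + n - 1" by simp_all
    then show ?thesis
      by (simp only: ifac_pred u_def mult_ac)
  qed
  \<comment> \<open>Divided by \<open>h n\<close>, both sides become 1 - q^K (x + 1/x) + q^(2K); the
    terms in q^(K-n) and q^(K+n) cancel.\<close>
  have key: "q ^ K + h n * ((1 - q powi (int K - n)) * (1 - q powi (int K + n))) =
      (1 - x * q ^ K) * (1 - 1 / x * q ^ K) * h n"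
    using factors_nonzero[of n]
    by (simp add: h_def power_int_diff power_int_add divide_simps) algebra
  have "(\<Sum>r<Suc K. qpoch2 x (1/x) q r * q ^ r * (ifac (int r - n) * ifac (int r + n))) =
      P * (q ^ K + h n * ((1 - q powi (int K - n)) * (1 - q powi (int K + n)))) * u"
    using Suc.IH unfolding pred by (simp add: P_def u_def algebra_simps)
  also have "\<dots> = qpoch2 x (1/x) q (Suc K) * (h n * u)"
    unfolding key by (simp add: P_def qpoch2_def qpoch_Suc mult_ac)
  finally show ?case by (simp add: u_def)
qed

definition H :: "int \<Rightarrow> int \<Rightarrow> complex" where
  "H e c = (\<Sum>\<^sub>\<infinity>m::int. q powi (3*m^2 + e*m) * h (3*m + c))"

lemma H_has_sum: "((\<lambda>m::int. q powi (3*m^2 + e*m) * h (3*m + c)) has_sum H e c) UNIV"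
proof -
  obtain C where C: "\<And>n. norm (h n) \<le> C" using h_bounded by blast
  then show ?thesis
    unfolding H_def by (intro has_sum_infsum theta_bounded_summable)
qed

lemma bailey_sums:
  "(\<lambda>r. qpoch2 x (1/x) q r * q ^ r * S e (int r - c) (int r + c)) sums
     (qpoch2_inf x (1/x) q / (qpoch_inf q q)^2 * H e c)"
proof -
  define t where "t m = q powi (3*m^2 + e*m)" for m :: int
  define G where "G K m = t m * (h (3*m + c) * (ifac (int K - 1 - (3*m + c)) * ifac (int K - 1 + (3*m + c))))"
    for K :: nat and m
  obtain D where D: "D > 0" "\<And>k. norm (ifac k) \<le> D" using ifac_bounded by blast
  obtain C where C: "\<And>n. norm (h n) \<le> C" using h_bounded by blast
  have C0: "C \<ge> 0" using C[of 0] norm_ge_zero order_trans by blast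
  \<comment> \<open>The finite sum over \<open>r\<close> is moved inside the sum over
    \<open>m\<close> and telescoped at \<open>n = 3*m + c\<close>.\<close>
  have partial: "((\<lambda>m. qpoch2 x (1/x) q K * G K m) has_sum
      (\<Sum>r<K. qpoch2 x (1/x) q r * q ^ r * S e (int r - c) (int r + c))) UNIV" for K
  proof -
    have "((\<lambda>m. \<Sum>r<K. qpoch2 x (1/x) q r * q ^ r *
        (t m * (ifac (int r - c - 3*m) * ifac (int r + c + 3*m)))) has_sum
      (\<Sum>r<K. qpoch2 x (1/x) q r * q ^ r * S e (int r - c) (int r + c))) UNIV"
      unfolding t_def by (intro has_sum_sum has_sum_cmult_right S_has_sum)
    also have "(\<lambda>m. \<Sum>r<K. qpoch2 x (1/x) q r * q ^ r *
        (t m * (ifac (int r - c - 3*m) * ifac (int r + c + 3*m)))) = (\<lambda>m. qpoch2 x (1/x) q K * G K m)"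
    proof
      fix m
      have "(\<Sum>r<K. qpoch2 x (1/x) q r * q ^ r *
          (t m * (ifac (int r - c - 3*m) * ifac (int r + c + 3*m)))) =
        t m * (\<Sum>r<K. qpoch2 x (1/x) q r * q ^ r *
          (ifac (int r - (3*m + c)) * ifac (int r + (3*m + c))))"
        by (simp add: sum_distrib_left algebra_simps)
      then show "(\<Sum>r<K. qpoch2 x (1/x) q r * q ^ r *
          (t m * (ifac (int r - c - 3*m) * ifac (int r + c + 3*m)))) = qpoch2 x (1/x) q K * G K m"
        unfolding bailey_telescope by (simp add: G_def mult_ac)
    qed
    finally show ?thesis .
  qed
  have lim_G: "(\<lambda>K. G K m) \<longlonglongrightarrow> t m * h (3*m + c) / (qpoch_inf q q)^2" for m
  proof -
    have "(\<lambda>K. t m * (h (3*m + c) * (ifac (int K + (- 1 - (3*m + c))) * ifac (int K + (- 1 + (3*m + c))))))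
        \<longlonglongrightarrow> t m * (h (3*m + c) * (1 / qpoch_inf q q * (1 / qpoch_inf q q)))"
      by (intro tendsto_mult tendsto_const ifac_tendsto)
    then show ?thesis
      by (simp add: G_def power2_eq_square algebra_simps)
  qed
  \<comment> \<open>The majorant does not depend on \<open>K\<close>, so the limit in
    \<open>K\<close> may be exchanged with the sum over \<open>m\<close>.\<close>
  have unif: "uniform_limit UNIV (\<lambda>X K. \<Sum>m\<in>X. G K m) (\<lambda>K. \<Sum>\<^sub>\<infinity>m. G K m) (finite_subsets_at_top UNIV)"
  proof (rule Weierstrass_m_test_general)
    show "(\<lambda>m. norm (t m) * (C * (D * D))) summable_on UNIV"
      unfolding t_def by (intro summable_on_cmult_left theta_abs_summable)
    show "norm (G K m) \<le> norm (t m) * (C * (D * D))" for m K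
      unfolding G_def norm_mult using D C C0
      by (intro mult_mono mult_nonneg_nonneg) (auto intro: less_imp_le)
  qed
  have lim_H: "((\<lambda>X. \<Sum>m\<in>X. t m * h (3*m + c) / (qpoch_inf q q)^2) \<longlongrightarrow> H e c / (qpoch_inf q q)^2)
      (finite_subsets_at_top UNIV)"
    using has_sum_divide_const[OF H_has_sum[of e c], of "(qpoch_inf q q)^2"] unfolding has_sum_def t_def .
  have "(\<lambda>K. \<Sum>\<^sub>\<infinity>m. G K m) \<longlonglongrightarrow> H e c / (qpoch_inf q q)^2"
    by (rule swap_uniform_limit'[OF _ lim_H unif]) (auto intro!: tendsto_sum lim_G)
  then have "(\<lambda>K. qpoch2 x (1/x) q K * (\<Sum>\<^sub>\<infinity>m. G K m)) \<longlonglongrightarrow>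
      qpoch2_inf x (1/x) q * (H e c / (qpoch_inf q q)^2)"
    by (intro tendsto_mult qpoch2_tendsto q_less)
  also have "(\<lambda>K. qpoch2 x (1/x) q K * (\<Sum>\<^sub>\<infinity>m. G K m)) =
      (\<lambda>K. \<Sum>r<K. qpoch2 x (1/x) q r * q ^ r * S e (int r - c) (int r + c))"
    using infsumI[OF partial] by (simp add: infsum_cmult_right')
  finally show ?thesis unfolding sums_def by simp
qed

section \<open>Evaluation of the two unilateral series\<close>

lemma sums_even:
  "(\<lambda>n. qpoch2 x (1/x) q n / qpoch q q (2*n) * (q ^ n - 1) * q ^ (n^2)) sums
     (qpoch2_inf x (1/x) q / (qpoch_inf q q)^2 * ((H (-1) 0 - H (-2) 0) - (H 1 1 - q * H 4 1)))"
proof -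
  let ?w = "\<lambda>r. qpoch2 x (1/x) q r * q ^ r"
  let ?P = "qpoch2_inf x (1/x) q / (qpoch_inf q q)^2"
  have "(\<lambda>r. (?w r * S (-1) (int r - 0) (int r + 0) - ?w r * S (-2) (int r - 0) (int r + 0)) -
      (?w r * S 1 (int r - 1) (int r + 1) - q * (?w r * S 4 (int r - 1) (int r + 1)))) sums
     ((?P * H (-1) 0 - ?P * H (-2) 0) - (?P * H 1 1 - q * (?P * H 4 1)))"
    by (intro sums_diff sums_mult bailey_sums)
  also have "(?P * H (-1) 0 - ?P * H (-2) 0) - (?P * H 1 1 - q * (?P * H 4 1)) =
      ?P * ((H (-1) 0 - H (-2) 0) - (H 1 1 - q * H 4 1))"
    by (simp only: right_diff_distrib mult_ac)
  also have "(\<lambda>r. (?w r * S (-1) (int r - 0) (int r + 0) - ?w r * S (-2) (int r - 0) (int r + 0)) -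
      (?w r * S 1 (int r - 1) (int r + 1) - q * (?w r * S 4 (int r - 1) (int r + 1)))) =
      (\<lambda>n. qpoch2 x (1/x) q n / qpoch q q (2*n) * (q ^ n - 1) * q ^ (n^2))"
  proof
    fix r :: nat
    let ?A = "A (int r) (int r)" and ?B = "B (int r) (int r)"
    have "(?w r * S (-1) (int r - 0) (int r + 0) - ?w r * S (-2) (int r - 0) (int r + 0)) -
      (?w r * S 1 (int r - 1) (int r + 1) - q * (?w r * S 4 (int r - 1) (int r + 1))) = ?w r * (?A - ?B)"
      \<comment> \<open>The exponent -2 fits the bilateral series, while \<open>B\<close> contains
        exponent 2; on the diagonal reflection identifies the two sums.\<close>
      using S_reflect[of "-2" "int r" "int r"] by (simp add: A_def B_def algebra_simps)
    also have "\<dots> = qpoch2 x (1/x) q r * (q powi int r * q powi ((int r)^2) - q powi int r * q powi ((int r)^2 - int r)) * ifac (2 * int r)"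
      by (simp add: A_diag B_diag algebra_simps)
    also have "q powi int r * q powi ((int r)^2 - int r) = q powi ((int r)^2)"
      using power_int_add[of q "int r" "(int r)^2 - int r"] by simp
    also have "q powi ((int r)^2) = q ^ (r^2)"
      using power_int_of_nat[of q "r^2"] by simp
    also have "ifac (2 * int r) = 1 / qpoch q q (2 * r)"
      using ifac_nat[of "2 * r"] by simp
    also have "qpoch2 x (1/x) q r * (q powi int r * q ^ (r^2) - q ^ (r^2)) * (1 / qpoch q q (2 * r)) =
        qpoch2 x (1/x) q r / qpoch q q (2*r) * (q ^ r - 1) * q ^ (r^2)"
      by (simp add: algebra_simps diff_divide_distrib)
    finally show "(?w r * S (-1) (int r - 0) (int r + 0) - ?w r * S (-2) (int r - 0) (int r + 0)) -
      (?w r * S 1 (int r - 1) (int r + 1) - q * (?w r * S 4 (int r - 1) (int r + 1))) =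
      qpoch2 x (1/x) q r / qpoch q q (2*r) * (q ^ r - 1) * q ^ (r^2)" .
  qed
  finally show ?thesis .
qed

text \<open>The instances \<open>c = 1\<close> and \<open>c = 2\<close> of
  \<open>bailey_sums\<close> combine to \<open>A (r - 1) (r + 1)\<close>. Its term at
  \<open>r = 0\<close> vanishes, so the series can start at \<open>r = n + 1\<close>.\<close>

lemma sums_odd:
  "(\<lambda>n. qpoch2 (x*q) (q/x) q n / qpoch q q (2*n + 1) * q ^ (n^2 + n)) sums
     (qpoch2_inf (x*q) (q/x) q / (qpoch_inf q q)^2 * (1/q * H (-1) 1 - 1/q * H 1 2))"
proof -
  let ?w = "\<lambda>r. qpoch2 x (1/x) q r * q ^ r"
  let ?P = "qpoch2_inf x (1/x) q / (qpoch_inf q q)^2"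
  \<comment> \<open>The factor common to both sides after the shift: \<open>q\<close> comes from
    q^(n+1), the rest from the first factors of the shifted symbols.\<close>
  define c where "c = q * ((1 - x) * (1 - 1/x))"
  have c: "c \<noteq> 0" using factors_nonzero[of 0] by (simp add: c_def)
  define f where "f r = ?w r * A (int r - 1) (int r + 1)" for r
  have "(\<lambda>r. ?w r * S (-1) (int r - 1) (int r + 1) - ?w r * S 1 (int r - 2) (int r + 2)) sums
      (?P * H (-1) 1 - ?P * H 1 2)"
    by (intro sums_diff bailey_sums)
  moreover have "int r - 1 - 1 = int r - 2" "int r + 1 + 1 = int r + 2" for r by simp_all
  ultimately have "f sums (?P * (H (-1) 1 - H 1 2))"
    by (simp only: f_def[abs_def] A_def right_diff_distrib)
  moreover have "f 0 = 0"
    using A_offdiag[of 0] by (simp add: f_def)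
  ultimately have "(\<lambda>n. f (Suc n)) sums (?P * (H (-1) 1 - H 1 2))"
    by (simp add: sums_Suc_iff)
  also have "?P * (H (-1) 1 - H 1 2) =
      c * (qpoch2_inf (x*q) (q/x) q / (qpoch_inf q q)^2 * (1/q * H (-1) 1 - 1/q * H 1 2))"
    unfolding qpoch2_inf_shift[OF q_less, of x "1/x"] right_diff_distrib[symmetric]
    by (simp add: c_def)
  also have "(\<lambda>n. f (Suc n)) =
      (\<lambda>n. c * (qpoch2 (x*q) (q/x) q n / qpoch q q (2*n + 1) * q ^ (n^2 + n)))"
  proof
    fix n
    have "A (int (Suc n) - 1) (int (Suc n) + 1) =
        (q powi ((int (Suc n) - 1)^2) - q powi ((int (Suc n))^2 + 1)) * ifac (2 * int (Suc n))"
      by (rule A_offdiag) simp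
    also have "(int (Suc n) - 1)^2 = int (n^2)" by simp
    also have "(int (Suc n))^2 + 1 = int (n^2) + (2 * int n + 2)"
      by (simp add: power2_eq_square algebra_simps)
    also have "2 * int (Suc n) = 2 * int n + 2" by simp
    also have "(q powi int (n^2) - q powi (int (n^2) + (2 * int n + 2))) * ifac (2 * int n + 2) =
        (q powi (int (n^2)) - q powi (int (n^2)) * q powi (2 * int n + 2)) * ifac (2 * int n + 2)"
      by (simp only: power_int_add q_nonzero simp_thms)
    \<comment> \<open>The difference equals q^(n^2) (1 - q^(2n+2)), and its second factor lowers the
      factorial index to the odd number 2n+1.\<close>
    also have "\<dots> = q ^ (n^2) * ifac (int (2 * n + 1))"
    proof -
      have "ifac (int (2 * n + 1)) = (1 - q powi (2 * int n + 2)) * ifac (2 * int n + 2)"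
        using ifac_pred[of "2 * int n + 2"] by (simp add: add.commute)
      then show ?thesis
        by (simp only: power_int_of_nat right_diff_distrib left_diff_distrib mult_1_left mult_1_right mult.assoc)
    qed
    finally have "A (int (Suc n) - 1) (int (Suc n) + 1) = q ^ (n^2) / qpoch q q (2*n + 1)"
      by (simp only: ifac_nat times_divide_eq_right mult_1_right)
    then show "f (Suc n) = c * (qpoch2 (x*q) (q/x) q n / qpoch q q (2*n + 1) * q ^ (n^2 + n))"
      unfolding f_def by (simp add: c_def qpoch2_Suc_shift power_add)
  qed
  finally show ?thesis
    unfolding sums_mult_iff[OF c] .
qed

section \<open>The four bilateral series as values of \<open>H\<close>\<close>

lemma power_times_h:
  "q powi a * h k = q powi (a + k) / ((1 - x * q powi k) * (1 - q powi k / x))"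
  by (simp add: h_def power_int_add)

text \<open>The numerator q^(3n) of \<open>h\<close> turns the linear exponents -n and -2n into 2n
  and n, the two terms of the expanded numerator.\<close>

lemma has_sum_even_0:
  "((\<lambda>n::int. q powi (3*n^2 + n) * (q powi n - 1) /
      ((1 - x * q powi (3*n)) * (1 - q powi (3*n) / x))) has_sum (H (-1) 0 - H (-2) 0)) UNIV"
proof -
  have "q powi (3*n^2 + n) * (q powi n - 1) / ((1 - x * q powi (3*n)) * (1 - q powi (3*n) / x)) =
      q powi (3*n^2 + (-1)*n) * h (3*n + 0) - q powi (3*n^2 + (-2)*n) * h (3*n + 0)" for n
  proof -
    have "q powi (3*n^2 + n) * (q powi n - 1) =
        q powi (3*n^2 + (-1)*n + (3*n + 0)) - q powi (3*n^2 + (-2)*n + (3*n + 0))"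
      by (simp add: right_diff_distrib add.commute flip: power_int_add)
    then show ?thesis
      unfolding power_times_h by (simp add: diff_divide_distrib)
  qed
  then show ?thesis
    by (simp only:) (intro has_sum_minus H_has_sum)
qed

text \<open>The numerator of \<open>h\<close> is now q^(3n+1), and the extra \<open>q\<close> before
  \<open>H 4 1\<close> completes the exponent 3n^2 + 7n + 2 of the second term.\<close>

lemma has_sum_even_1:
  "((\<lambda>n::int. q powi (3*n^2 + 4*n + 1) * (1 - q powi (3*n + 1)) /
      ((1 - x * q powi (3*n + 1)) * (1 - q powi (3*n + 1) / x))) has_sum (H 1 1 - q * H 4 1)) UNIV"
proof -
  have "q powi (3*n^2 + 4*n + 1) * (1 - q powi (3*n + 1)) / ((1 - x * q powi (3*n + 1)) * (1 - q powi (3*n + 1) / x)) =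
      q powi (3*n^2 + 1*n) * h (3*n + 1) - q * (q powi (3*n^2 + 4*n) * h (3*n + 1))" for n
  proof -
    have "3*n^2 + 1*n + (3*n + 1) = 3*n^2 + 4*n + 1" by simp
    moreover have "q * q powi (3*n^2 + 4*n + (3*n + 1)) = q powi (3*n^2 + 4*n + 1) * q powi (3*n + 1)"
      using power_int_add[of q 1 "3*n^2 + 4*n + (3*n + 1)"]
        power_int_add[of q "3*n^2 + 4*n + 1" "3*n + 1"] by (simp add: algebra_simps)
    ultimately have "q powi (3*n^2 + 4*n + 1) * (1 - q powi (3*n + 1)) =
        q powi (3*n^2 + 1*n + (3*n + 1)) - q * q powi (3*n^2 + 4*n + (3*n + 1))"
      by (simp only: right_diff_distrib mult_1_right)
    then show ?thesis
      unfolding power_times_h by (simp add: diff_divide_distrib)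
  qed
  then show ?thesis
    by (simp only:) (intro has_sum_minus has_sum_cmult_right H_has_sum)
qed

lemma has_sum_odd_1:
  "((\<lambda>n::int. q powi (3*n^2 + 2*n) /
      ((1 - x * q powi (3*n + 1)) * (1 - q powi (3*n + 1) / x))) has_sum (1/q * H (-1) 1)) UNIV"
proof -
  have "q powi (3*n^2 + 2*n) / ((1 - x * q powi (3*n + 1)) * (1 - q powi (3*n + 1) / x)) =
      1/q * (q powi (3*n^2 + (-1)*n) * h (3*n + 1))" for n
    unfolding power_times_h by (simp add: power_int_add)
  then show ?thesis
    by (simp only:) (intro has_sum_cmult_right H_has_sum)
qed

lemma has_sum_odd_2:
  "((\<lambda>n::int. q powi (3*n^2 + 4*n + 1) /
      ((1 - x * q powi (3*n + 2)) * (1 - q powi (3*n + 2) / x))) has_sum (1/q * H 1 2)) UNIV"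
proof -
  have "q powi (3*n^2 + 4*n + 1) / ((1 - x * q powi (3*n + 2)) * (1 - q powi (3*n + 2) / x)) =
      1/q * (q powi (3*n^2 + 1*n) * h (3*n + 2))" for n
  proof -
    have "3*n^2 + 1*n + (3*n + 2) = (3*n^2 + 4*n + 1) + 1" by simp
    then have "q powi (3*n^2 + 1*n + (3*n + 2)) = q powi (3*n^2 + 4*n + 1) * q"
      using power_int_add[of q "3*n^2 + 4*n + 1" 1] by (simp only: q_nonzero power_int_1_right simp_thms)
    then show ?thesis
      unfolding power_times_h by simp
  qed
  then show ?thesis
    by (simp only:) (intro has_sum_cmult_right H_has_sum)
qed

lemma qpoch2_inf_shift_nonzero: "qpoch2_inf (x*q) (q/x) q \<noteq> 0"
  using qpoch2_inf_shift[OF q_less, of x "1/x"] qpoch2_inf_nonzero by auto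

end

section \<open>Assembly of both identities\<close>

theorem corollary9:
  fixes q x :: complex
  assumes "0 < norm q" and "norm q < 1"
    and "x \<noteq> 0"
    and "\<forall>k::int. x \<noteq> q powi k"
  shows
    "(\<lambda>n::int. q powi (3*n^2 + n) * (q powi n - 1) /
          ((1 - x * q powi (3*n)) * (1 - q powi (3*n) / x)))
        summable_on UNIV \<and>
     (\<lambda>n::int. q powi (3*n^2 + 4*n + 1) * (1 - q powi (3*n + 1)) /
          ((1 - x * q powi (3*n + 1)) * (1 - q powi (3*n + 1) / x)))
        summable_on UNIV \<and>
     summable (\<lambda>n::nat. qpoch2 x (1/x) q n / qpoch q q (2*n) * (q ^ n - 1) * q ^ (n^2)) \<and>
     ((\<Sum>\<^sub>\<infinity>n::int. q powi (3*n^2 + n) * (q powi n - 1) /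
          ((1 - x * q powi (3*n)) * (1 - q powi (3*n) / x)))
      - (\<Sum>\<^sub>\<infinity>n::int. q powi (3*n^2 + 4*n + 1) * (1 - q powi (3*n + 1)) /
          ((1 - x * q powi (3*n + 1)) * (1 - q powi (3*n + 1) / x)))
      = (qpoch_inf q q)^2 / qpoch2_inf x (1/x) q
        * (\<Sum>n::nat. qpoch2 x (1/x) q n / qpoch q q (2*n) * (q ^ n - 1) * q ^ (n^2))) \<and>
     (\<lambda>n::int. q powi (3*n^2 + 2*n) /
          ((1 - x * q powi (3*n + 1)) * (1 - q powi (3*n + 1) / x)))
        summable_on UNIV \<and>
     (\<lambda>n::int. q powi (3*n^2 + 4*n + 1) /
          ((1 - x * q powi (3*n + 2)) * (1 - q powi (3*n + 2) / x)))
        summable_on UNIV \<and>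
     summable (\<lambda>n::nat. qpoch2 (x*q) (q/x) q n / qpoch q q (2*n + 1) * q ^ (n^2 + n)) \<and>
     ((\<Sum>\<^sub>\<infinity>n::int. q powi (3*n^2 + 2*n) /
          ((1 - x * q powi (3*n + 1)) * (1 - q powi (3*n + 1) / x)))
      - (\<Sum>\<^sub>\<infinity>n::int. q powi (3*n^2 + 4*n + 1) /
          ((1 - x * q powi (3*n + 2)) * (1 - q powi (3*n + 2) / x)))
      = (qpoch_inf q q)^2 / qpoch2_inf (x*q) (q/x) q
        * (\<Sum>n::nat. qpoch2 (x*q) (q/x) q n / qpoch q q (2*n + 1) * q ^ (n^2 + n)))"
proof -
  interpret punctured_disc_param q x
    using assms by unfold_locales auto
  show ?thesis
    \<comment> \<open>Once every series is replaced by its value in \<open>H\<close>, the prefactors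
      on the right are reciprocal and cancel because the infinite products are nonzero.\<close>
    unfolding infsumI[OF has_sum_even_0] infsumI[OF has_sum_even_1]
      infsumI[OF has_sum_odd_1] infsumI[OF has_sum_odd_2]
      sums_unique[OF sums_even, symmetric] sums_unique[OF sums_odd, symmetric]
    using has_sum_imp_summable[OF has_sum_even_0] has_sum_imp_summable[OF has_sum_even_1]
      has_sum_imp_summable[OF has_sum_odd_1] has_sum_imp_summable[OF has_sum_odd_2]
      sums_summable[OF sums_even] sums_summable[OF sums_odd]
      qpoch2_inf_nonzero qpoch2_inf_shift_nonzero qpoch_inf_q_nonzero
    by (intro conjI) simp_all
qed

end
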